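(* Let $w>0$. Every ordinary reduced polygon $P\subset H^2$ of minimal width $w$ is contained in a closed circular disk of radius $w$ centered at one of the boundary points of $P$; that is, there is $z\in\partial P$ such that $d(x,z)\le w$ for all $x\in P$.
   Context: $H^2$ is the hyperbolic plane (constant curvature $-1$) with geodesic distance $d$. A set is convex if it contains the geodesic segment joining any two of its points; a convex body is a compact convex set with non-empty interior; a polygon is a convex body that is the convex hull of finitely many points, and a $k$-gon is a polygon with $k$ vertices (a vertex is a point of the generating set not in the convex hull of the others). $\partial P$ denotes the boundary of $P$. Width: a line $\ell$ is a supporting line of a convex body $K$ if $K\cap\ell\neq\emptyset$ and $K$ lies in one of the closed half-planes bounded by $\ell$. The width of $K$ with respect to a supporting line $\ell$ is the distance between $\ell$ and a most distant supporting line $\ell'$ of $K$ from $\ell$. The minimal width (thickness) $w(K)$ is the minimum of the width over all supporting lines. Ordinary reduced polygon: let $n\ge 3$ be odd and let $P$ be a convex $n$-gon in $H^2$ with vertices $v_1,\dots,v_n$ in positively oriented cyclic order (indices mod $n$). The side opposite to $v_i$ is $[v_{i+\frac{n-1}{2}},v_{i+\frac{n+1}{2}}]$. $P$ of minimal width $w$ is called an ordinary reduced polygon if for every $i$ the distance of $v_i$ from its opposite side is $w$ and the orthogonal projection of $v_i$ onto the line of the opposite side lies in the relative interior of that side. *)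

theory Defs
  imports "HOL-Analysis.Analysis"
begin

section \<open>The hyperbolic plane (hyperboloid model)\<close>

definition mink :: "real^3 \<Rightarrow> real^3 \<Rightarrow> real" where
  "mink u v = u$1 * v$1 + u$2 * v$2 - u$3 * v$3"

typedef hyp2 = "{v :: real^3. mink v v = -1 \<and> v$3 > 0}"
  morphisms hvec Abs_hyp2
proof
  show "vector [0, 0, 1] \<in> {v :: real^3. mink v v = -1 \<and> v$3 > 0}"
    by (simp add: mink_def)
qed

lemma mink_commute: "mink u v = mink v u"
  by (simp add: mink_def mult.commute)

lemma hvec_mink_self: "mink (hvec x) (hvec x) = -1"
  and hvec_pos: "hvec x $ 3 > 0"
  using hvec[of x] by auto

lemma hvec_third_sq: "(hvec x $ 3)\<^sup>2 = 1 + (hvec x $ 1)\<^sup>2 + (hvec x $ 2)\<^sup>2"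
  using hvec_mink_self[of x] by (simp add: mink_def power2_eq_square)

lemma hvec_prod_sq:
  "(hvec x $ 3 * hvec y $ 3)\<^sup>2 = (1 + hvec x $ 1 * hvec y $ 1 + hvec x $ 2 * hvec y $ 2)\<^sup>2
     + ((hvec x $ 1 - hvec y $ 1)\<^sup>2 + (hvec x $ 2 - hvec y $ 2)\<^sup>2
        + (hvec x $ 1 * hvec y $ 2 - hvec x $ 2 * hvec y $ 1)\<^sup>2)"
  unfolding power_mult_distrib hvec_third_sq
  by (simp add: power2_eq_square algebra_simps)

lemma mink_hvec_le: "mink (hvec x) (hvec y) \<le> -1"
proof -
  have "(1 + hvec x $ 1 * hvec y $ 1 + hvec x $ 2 * hvec y $ 2)\<^sup>2 \<le> (hvec x $ 3 * hvec y $ 3)\<^sup>2"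
    unfolding hvec_prod_sq by simp
  then have "1 + hvec x $ 1 * hvec y $ 1 + hvec x $ 2 * hvec y $ 2 \<le> hvec x $ 3 * hvec y $ 3"
    by (rule power2_le_imp_le) (simp add: hvec_pos less_imp_le)
  then show ?thesis by (simp add: mink_def)
qed

lemma mink_hvec_eq_iff: "mink (hvec x) (hvec y) = -1 \<longleftrightarrow> x = y"
proof
  assume "mink (hvec x) (hvec y) = -1"
  then have "hvec x $ 3 * hvec y $ 3 = 1 + hvec x $ 1 * hvec y $ 1 + hvec x $ 2 * hvec y $ 2"
    by (simp add: mink_def)
  with hvec_prod_sq[of x y]
  have "(hvec x $ 1 - hvec y $ 1)\<^sup>2 + (hvec x $ 2 - hvec y $ 2)\<^sup>2
      + (hvec x $ 1 * hvec y $ 2 - hvec x $ 2 * hvec y $ 1)\<^sup>2 = 0"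
    by simp
  then have eq: "hvec x $ 1 = hvec y $ 1" "hvec x $ 2 = hvec y $ 2"
    by (smt (verit) zero_le_power2 power2_eq_iff_nonneg power_zero_numeral zero_eq_power2)+
  then have "(hvec x $ 3)\<^sup>2 = (hvec y $ 3)\<^sup>2"
    by (simp add: hvec_third_sq)
  then have "hvec x $ 3 = hvec y $ 3"
    by (simp add: hvec_pos less_imp_le)
  with eq have "hvec x = hvec y"
    by (simp add: vec_eq_iff forall_3)
  then show "x = y" by (simp add: hvec_inject)
qed (simp add: hvec_mink_self)

text \<open>The Gram determinant of three vectors of a Lorentzian 3-space is minus a square.\<close>
lemma mink_gram:
  fixes u v w :: "real^3"
  assumes "mink u u = -1" "mink v v = -1" "mink w w = -1"
  shows "(mink u w + mink u v * mink v w)\<^sup>2 \<le> ((mink u v)\<^sup>2 - 1) * ((mink v w)\<^sup>2 - 1)"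
proof -
  have "mink u u * (mink v v * mink w w - (mink v w)\<^sup>2)
      - mink u v * (mink u v * mink w w - mink v w * mink u w)
      + mink u w * (mink u v * mink v w - mink v v * mink u w)
      = - (u$1 * (v$2 * w$3 - v$3 * w$2) - u$2 * (v$1 * w$3 - v$3 * w$1)
           + u$3 * (v$1 * w$2 - v$2 * w$1))\<^sup>2"
    unfolding mink_def by algebra
  also have "\<dots> \<le> 0" by simp
  finally show ?thesis
    unfolding assms by (simp add: power2_eq_square algebra_simps)
qed

instantiation hyp2 :: metric_space
begin

definition dist_hyp2 :: "hyp2 \<Rightarrow> hyp2 \<Rightarrow> real" where
  "dist_hyp2 x y = arcosh (- mink (hvec x) (hvec y))"

definition uniformity_hyp2 :: "(hyp2 \<times> hyp2) filter" where
  "uniformity_hyp2 = (INF e\<in>{0<..}. principal {(x, y). dist x y < e})"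

definition open_hyp2 :: "hyp2 set \<Rightarrow> bool" where
  "open_hyp2 U \<longleftrightarrow> (\<forall>x\<in>U. eventually (\<lambda>(x', y). x' = x \<longrightarrow> y \<in> U) uniformity)"

instance
proof
  fix x y z :: hyp2
  have ge1: "- mink (hvec a) (hvec b) \<ge> 1" for a b
    using mink_hvec_le[of a b] by simp
  show "dist x y = 0 \<longleftrightarrow> x = y"
    using ge1[of x y] mink_hvec_eq_iff[of x y] by (auto simp: dist_hyp2_def)
  have tri: "dist x z \<le> dist x y + dist y z" for x y z :: hyp2
  proof -
    let ?p = "- mink (hvec x) (hvec y)" and ?r = "- mink (hvec y) (hvec z)"
    let ?q = "- mink (hvec x) (hvec z)"
    have nonneg: "?p\<^sup>2 - 1 \<ge> 0" "?r\<^sup>2 - 1 \<ge> 0"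
      using ge1 by (simp_all only: diff_ge_0_iff_ge one_le_power)
    have "(?q - ?p * ?r)\<^sup>2 \<le> (?p\<^sup>2 - 1) * (?r\<^sup>2 - 1)"
      using mink_gram[OF hvec_mink_self[of x] hvec_mink_self[of y] hvec_mink_self[of z]]
      by (simp add: power2_eq_square algebra_simps)
    then have "\<bar>?q - ?p * ?r\<bar> \<le> sqrt ((?p\<^sup>2 - 1) * (?r\<^sup>2 - 1))"
      by (metis real_sqrt_le_mono real_sqrt_abs)
    then have "?q \<le> ?p * ?r + sqrt (?p\<^sup>2 - 1) * sqrt (?r\<^sup>2 - 1)"
      unfolding real_sqrt_mult by linarith
    also have "\<dots> = cosh (arcosh ?p + arcosh ?r)"
      by (simp only: cosh_add cosh_arcosh_real[OF ge1] sinh_arcosh_real[OF ge1])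
    finally have "arcosh ?q \<le> arcosh (cosh (arcosh ?p + arcosh ?r))"
      using ge1[of x z] cosh_real_ge_1 by (metis arcosh_less_iff_real not_less)
    also have "\<dots> = arcosh ?p + arcosh ?r"
      by (intro arcosh_cosh_real add_nonneg_nonneg arcosh_nonneg_real ge1)
    finally show ?thesis by (simp add: dist_hyp2_def)
  qed
  show "dist x y \<le> dist x z + dist y z"
    using tri[of x y z] by (simp add: dist_hyp2_def mink_commute)
qed (rule uniformity_hyp2_def open_hyp2_def)+

end

section \<open>Convexity\<close>

text \<open>The geodesic segment as the metric interval; the two agree because the plane is uniquely
  geodesic.\<close>
definition hseg :: "hyp2 \<Rightarrow> hyp2 \<Rightarrow> hyp2 set" where
  "hseg x y = {z. dist x z + dist z y = dist x y}"

definition hconvex :: "hyp2 set \<Rightarrow> bool" where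
  "hconvex S \<longleftrightarrow> (\<forall>x\<in>S. \<forall>y\<in>S. hseg x y \<subseteq> S)"

definition convex_body :: "hyp2 set \<Rightarrow> bool" where
  "convex_body K \<longleftrightarrow> compact K \<and> hconvex K \<and> interior K \<noteq> {}"

definition hull_vertices :: "hyp2 set \<Rightarrow> hyp2 set" where
  "hull_vertices V = {p \<in> V. p \<notin> hconvex hull (V - {p})}"

text \<open>Positive exactly when \<open>x\<close>, \<open>y\<close>, \<open>z\<close> are the vertices of a nondegenerate triangle listed
  counterclockwise (as seen in the Klein disk, the central projection to height 1).\<close>
definition orientation :: "hyp2 \<Rightarrow> hyp2 \<Rightarrow> hyp2 \<Rightarrow> real" where
  "orientation x y z = det (vector [hvec x, hvec y, hvec z] :: real^3^3)"

text \<open>\<open>P\<close> is a convex \<open>n\<close>-gon with vertices \<open>v 0, \<dots>, v (n - 1)\<close> in positively oriented cyclic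
  order.\<close>
definition oriented_gon :: "nat \<Rightarrow> (nat \<Rightarrow> hyp2) \<Rightarrow> hyp2 set \<Rightarrow> bool" where
  "oriented_gon n v P \<longleftrightarrow>
     convex_body P \<and>
     (\<exists>V. finite V \<and> P = hconvex hull V \<and> bij_betw v {..<n} (hull_vertices V)) \<and>
     (\<forall>i j k. i < j \<and> j < k \<and> k < n \<longrightarrow> orientation (v i) (v j) (v k) > 0)"

section \<open>Lines and width\<close>

text \<open>For a spacelike \<open>u\<close>, the line with normal \<open>u\<close> and one of the two closed half-planes it
  bounds; the other one is \<open>hhalfplane (- u)\<close>.\<close>
definition spacelike :: "real^3 \<Rightarrow> bool" where
  "spacelike u \<longleftrightarrow> mink u u > 0"

definition hline :: "real^3 \<Rightarrow> hyp2 set" where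
  "hline u = {x. mink u (hvec x) = 0}"

definition hhalfplane :: "real^3 \<Rightarrow> hyp2 set" where
  "hhalfplane u = {x. mink u (hvec x) \<ge> 0}"

definition is_hline :: "hyp2 set \<Rightarrow> bool" where
  "is_hline l \<longleftrightarrow> (\<exists>u. spacelike u \<and> l = hline u)"

definition supporting_line :: "hyp2 set \<Rightarrow> hyp2 set \<Rightarrow> bool" where
  "supporting_line K l \<longleftrightarrow>
     (\<exists>u. spacelike u \<and> l = hline u \<and> K \<inter> l \<noteq> {} \<and> K \<subseteq> hhalfplane u)"

text \<open>For a convex body the supremum and the infimum below are attained, by compactness.\<close>
definition width_wrt :: "hyp2 set \<Rightarrow> hyp2 set \<Rightarrow> real" where
  "width_wrt K l = Sup {setdist l l' | l'. supporting_line K l'}"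

definition minimal_width :: "hyp2 set \<Rightarrow> real" where
  "minimal_width K = Inf {width_wrt K l | l. supporting_line K l}"

text \<open>\<open>p\<close> lies on \<open>l\<close> and on a line through \<open>x\<close> perpendicular to \<open>l\<close>; lines are perpendicular
  iff their normals are \<open>mink\<close>-orthogonal.\<close>
definition orth_proj :: "hyp2 \<Rightarrow> hyp2 set \<Rightarrow> hyp2 \<Rightarrow> bool" where
  "orth_proj x l p \<longleftrightarrow>
     (\<exists>u u'. spacelike u \<and> spacelike u' \<and> mink u u' = 0 \<and> l = hline u \<and>
       x \<in> hline u' \<and> p \<in> hline u' \<and> p \<in> l)"

section \<open>Ordinary reduced polygons\<close>

definition opp1 :: "nat \<Rightarrow> (nat \<Rightarrow> hyp2) \<Rightarrow> nat \<Rightarrow> hyp2" where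
  "opp1 n v i = v ((i + (n - 1) div 2) mod n)"

definition opp2 :: "nat \<Rightarrow> (nat \<Rightarrow> hyp2) \<Rightarrow> nat \<Rightarrow> hyp2" where
  "opp2 n v i = v ((i + (n + 1) div 2) mod n)"

definition ordinary_reduced_polygon :: "hyp2 set \<Rightarrow> real \<Rightarrow> bool" where
  "ordinary_reduced_polygon P w \<longleftrightarrow>
     (\<exists>n v. odd n \<and> n \<ge> 3 \<and> oriented_gon n v P \<and> minimal_width P = w \<and>
       (\<forall>i<n. infdist (v i) (hseg (opp1 n v i) (opp2 n v i)) = w \<and>
         (\<exists>l p. is_hline l \<and> opp1 n v i \<in> l \<and> opp2 n v i \<in> l \<and> orth_proj (v i) l p \<and>
            p \<in> hseg (opp1 n v i) (opp2 n v i) - {opp1 n v i, opp2 n v i})))"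

end

theory Submission
  imports Defs
begin

text \<open>Let \<open>n = 2 * m + 1\<close>, number the vertices \<open>V i\<close> cyclically, and let \<open>T i\<close> be the point of the
  side \<open>[V (i + m), V (i + m + 1)]\<close> nearest to \<open>V i\<close>, at distance \<open>w\<close>. Some \<open>T i\<close> is the required
  centre. The proof uses a single metric fact (\<open>crossing_inequality\<close>): if \<open>a, b, c, d\<close> occur on the
  boundary in this order, then the segments \<open>ac\<close> and \<open>bd\<close> meet, and the triangle inequality at the
  meeting point gives \<open>dist a b + dist c d \<le> dist a c + dist b d\<close>.

  The segment from \<open>V i\<close> to \<open>T i\<close> splits the other vertices into those after \<open>V i\<close>,
  \<open>V (i + 1), \<dots>, V (i + m)\<close>, and those before it, \<open>V (i + m + 1), \<dots>, V (i + 2 * m)\<close>.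
  Suppose every \<open>T i\<close> has a vertex at distance greater than \<open>w\<close>, and say that \<open>i\<close> leans forward or
  backward according to whether the vertex farthest from \<open>T i\<close> lies after or before \<open>V i\<close>.

  \<^item> Both kinds occur. Let \<open>V p\<close>, \<open>V q\<close> with \<open>p < q \<le> p + m\<close> be a farthest pair of vertices. If \<open>V k\<close>
    lies after \<open>V q\<close>, the points \<open>V p, V q, V k, T q\<close> are in cyclic order, so
    \<open>dist (V p) (V q) + dist (V k) (T q) \<le> dist (V p) (V k) + w\<close>; since \<open>dist (V p) (V k) \<le> dist (V p) (V q)\<close>,
    the vertex \<open>V k\<close> is within \<open>w\<close> of \<open>T q\<close>. So \<open>q\<close> leans backward, and symmetrically \<open>p\<close> leans forward.

  \<^item> A forward \<open>i\<close> is never followed by a backward \<open>i + 1\<close>. With farthest vertices \<open>V k\<close> of \<open>T i\<close> and \<open>V l\<close> of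
    \<open>T (i + 1)\<close>, the points \<open>V k, T i, T (i + 1), V l\<close> are in cyclic order, and the inequality says that
    exchanging \<open>V k\<close> and \<open>V l\<close> does not decrease the sum of the distances, against their choice.

  Going from \<open>p\<close> to \<open>q\<close> contradicts the second point; this is \<open>exists_central_foot\<close>, an argument in
  an arbitrary metric space. Ties make the words forward and backward ambiguous, so there they are replaced by
  comparing the two one-sided maximal distances.

  The hyperboloid model supplies the geometry. Points of a segment are the nonnegative combinations
  of its endpoints that lie on the hyperboloid, so the meeting point of two diagonals is read off from
  the linear relation between four vectors of three-space. Balls and half-planes are
  sublevel sets of linear functionals, whose maxima over a polygon are controlled by
  its vertices (\<open>linear_le_on_hull\<close>). This extends the distance bound from the vertices to the polygon
  and puts the polygon on one side of each of its sides, so that \<open>T i\<close> is a boundary point.\<close>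

section \<open>Segments as linear combinations\<close>

lemma mink_linear_right: "linear (mink u)"
  by (rule linearI) (simp_all add: mink_def algebra_simps)

lemma mink_combination_right:
  "mink u (\<alpha> *\<^sub>R x + \<beta> *\<^sub>R y) = \<alpha> * mink u x + \<beta> * mink u y"
  by (simp add: mink_def algebra_simps)

lemma mink_combination_self:
  "mink (\<alpha> *\<^sub>R x + \<beta> *\<^sub>R y) (\<alpha> *\<^sub>R x + \<beta> *\<^sub>R y)
    = \<alpha>\<^sup>2 * mink x x + 2 * \<alpha> * \<beta> * mink x y + \<beta>\<^sup>2 * mink y y"
  by (simp add: mink_def algebra_simps power2_eq_square)

lemma cosh_dist: "cosh (dist x y) = - mink (hvec x) (hvec y)"
  using mink_hvec_le[of x y] by (simp add: dist_hyp2_def)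

lemma mink_hvec: "mink (hvec x) (hvec y) = - cosh (dist x y)"
  by (simp add: cosh_dist)

lemma point_on_upper_sheet:
  assumes "mink u u = -1" and "u $ 3 > 0"
  obtains x where "hvec x = u"
  using assms by (metis (mono_tags, lifting) Abs_hyp2_inverse mem_Collect_eq)

text \<open>A timelike vector is on the upper sheet as soon as its product with one point is negative, because
  two vectors on opposite sheets have a positive product.\<close>
lemma point_at_timelike_vector:
  assumes "mink u u = -1" and "mink (hvec a) u < 0"
  obtains x where "hvec x = u"
proof -
  have "(u $ 3)\<^sup>2 = 1 + (u $ 1)\<^sup>2 + (u $ 2)\<^sup>2"
    using assms(1) by (simp add: mink_def power2_eq_square)
  then have "(u $ 3)\<^sup>2 > 0"
    by (simp add: add_pos_nonneg)
  then have "u $ 3 \<noteq> 0" by simp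
  moreover have "\<not> u $ 3 < 0"
  proof
    assume "u $ 3 < 0"
    then obtain x where "hvec x = - u"
      using point_on_upper_sheet[of "- u"] assms(1) by (auto simp: mink_def)
    then have "mink (hvec a) (- u) \<le> -1"
      using mink_hvec_le by metis
    then show False using assms(2) by (simp add: mink_def)
  qed
  ultimately have "u $ 3 > 0" by linarith
  with assms(1) show thesis using point_on_upper_sheet that by blast
qed

lemma sinh_add_squared:
  fixes s t :: real
  shows "(sinh (s + t))\<^sup>2 = (sinh s)\<^sup>2 + (sinh t)\<^sup>2 + 2 * sinh s * sinh t * cosh (s + t)"
proof -
  have "(cosh s)\<^sup>2 = 1 + (sinh s)\<^sup>2" "(cosh t)\<^sup>2 = 1 + (sinh t)\<^sup>2"
    by (simp_all add: cosh_square_eq)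
  then show ?thesis
    unfolding sinh_add cosh_add by algebra
qed

lemma sinh_add_gt:
  fixes s t :: real
  assumes "s > 0" "t > 0"
  shows "sinh s + sinh t < sinh (s + t)"
proof -
  have "sinh s * 1 < sinh s * cosh t" "1 * sinh t < cosh s * sinh t"
    using assms cosh_real_strict_mono[of 0 s] cosh_real_strict_mono[of 0 t]
    by (auto intro!: mult_strict_left_mono mult_strict_right_mono)
  then show ?thesis by (simp add: sinh_add)
qed

text \<open>Points \<open>a\<close>, \<open>b\<close> at distance \<open>s + t\<close> determine the vector
  \<open>(sinh t *\<^sub>R a + sinh s *\<^sub>R b) /\<^sub>R sinh (s + t)\<close>. It lies on the hyperboloid, and its product with \<open>c\<close> is
  \<open>-1\<close> when \<open>c\<close> is at distances \<open>s\<close> and \<open>t\<close> from \<open>a\<close> and \<open>b\<close>, so it is \<open>c\<close>. That the coefficients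
  add up to less than one away from the endpoints expresses the strict convexity of the hyperboloid; it
  makes balls strictly convex.\<close>
lemma hseg_combination:
  assumes "c \<in> hseg a b"
  obtains \<alpha> \<beta> where "\<alpha> \<ge> 0" "\<beta> \<ge> 0" "hvec c = \<alpha> *\<^sub>R hvec a + \<beta> *\<^sub>R hvec b"
    "c \<noteq> a \<Longrightarrow> \<beta> > 0" "c \<noteq> b \<Longrightarrow> \<alpha> > 0" "c \<noteq> a \<Longrightarrow> c \<noteq> b \<Longrightarrow> \<alpha> + \<beta> < 1"
proof (cases "a = b")
  case True
  with assms have "c = a" by (simp add: hseg_def dist_commute)
  with True show thesis using that[of 1 0] by simp
next
  case False
  define s t where "s = dist a c" and "t = dist c b"
  have D: "dist a b = s + t" and st: "s \<ge> 0" "t \<ge> 0" "s + t > 0"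
    using assms False by (auto simp: hseg_def s_def t_def)
  define \<alpha> \<beta> where "\<alpha> = sinh t / sinh (s + t)" and "\<beta> = sinh s / sinh (s + t)"
  have S: "sinh (s + t) > 0" using st by simp
  have nonneg: "\<alpha> \<ge> 0" "\<beta> \<ge> 0"
    using S st by (auto simp: \<alpha>_def \<beta>_def)
  let ?u = "\<alpha> *\<^sub>R hvec a + \<beta> *\<^sub>R hvec b"
  have self: "mink ?u ?u = -1"
  proof -
    have "mink ?u ?u = - (\<alpha>\<^sup>2 + 2 * \<alpha> * \<beta> * cosh (s + t) + \<beta>\<^sup>2)"
      unfolding mink_combination_self by (simp add: hvec_mink_self mink_hvec D)
    also have "\<alpha>\<^sup>2 + 2 * \<alpha> * \<beta> * cosh (s + t) + \<beta>\<^sup>2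
        = ((sinh s)\<^sup>2 + (sinh t)\<^sup>2 + 2 * sinh s * sinh t * cosh (s + t)) / (sinh (s + t))\<^sup>2"
      using S by (simp add: \<alpha>_def \<beta>_def field_simps power2_eq_square)
    also have "\<dots> = 1" using S by (simp flip: sinh_add_squared)
    finally show ?thesis .
  qed
  have "mink (hvec c) ?u = - (sinh t * cosh s + sinh s * cosh t) / sinh (s + t)"
    unfolding mink_combination_right
    by (simp add: mink_hvec \<alpha>_def \<beta>_def s_def t_def dist_commute add_divide_distrib diff_divide_distrib)
  also have "\<dots> = -1" using S by (simp add: sinh_add field_simps)
  finally have c: "mink (hvec c) ?u = -1" .
  obtain x where x: "hvec x = ?u"
    using point_at_timelike_vector[OF self, of c] c by auto
  with c have "c = x" using mink_hvec_eq_iff[of c x] by simp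
  then have "hvec c = ?u" using x by simp
  moreover have "\<beta> > 0" if "c \<noteq> a"
    using that S by (simp add: \<beta>_def s_def)
  moreover have "\<alpha> > 0" if "c \<noteq> b"
    using that S by (simp add: \<alpha>_def t_def)
  moreover have "\<alpha> + \<beta> < 1" if "c \<noteq> a" "c \<noteq> b"
  proof -
    have "s > 0" "t > 0" using that by (auto simp: s_def t_def)
    then have "sinh s + sinh t < sinh (s + t)" by (rule sinh_add_gt)
    then show ?thesis using S by (simp add: \<alpha>_def \<beta>_def field_simps)
  qed
  ultimately show thesis using nonneg that by blast
qed

text \<open>The hyperbolic sines of the distances from \<open>c\<close> to \<open>a\<close> and \<open>b\<close> are proportional to the coefficients \<open>\<beta>\<close> and
  \<open>\<alpha>\<close>, and the addition theorem for \<open>cosh\<close> then yields \<open>cosh (dist a b)\<close>.\<close>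
lemma combination_in_hseg:
  assumes "\<alpha> \<ge> 0" "\<beta> \<ge> 0" and c: "hvec c = \<alpha> *\<^sub>R hvec a + \<beta> *\<^sub>R hvec b"
  shows "c \<in> hseg a b"
proof -
  let ?C = "cosh (dist a b)"
  have norm: "\<alpha>\<^sup>2 + 2 * \<alpha> * \<beta> * ?C + \<beta>\<^sup>2 = 1"
    using hvec_mink_self[of c] unfolding c mink_combination_self
    by (simp add: hvec_mink_self mink_hvec)
  have ca: "cosh (dist a c) = \<alpha> + \<beta> * ?C" and cb: "cosh (dist c b) = \<alpha> * ?C + \<beta>"
    unfolding dist_commute[of c b] cosh_dist c mink_combination_right
    by (simp_all add: mink_hvec hvec_mink_self dist_commute)
  have sq: "(sinh (dist a b))\<^sup>2 = ?C\<^sup>2 - 1"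
    by (simp add: cosh_square_eq)
  have "(sinh (dist a c))\<^sup>2 = (\<beta> * sinh (dist a b))\<^sup>2"
  proof -
    have "(sinh (dist a c))\<^sup>2 = (\<alpha> + \<beta> * ?C)\<^sup>2 - 1"
      by (simp add: cosh_square_eq flip: ca)
    then show ?thesis using sq norm by algebra
  qed
  then have sa: "sinh (dist a c) = \<beta> * sinh (dist a b)"
    using assms by (simp add: power2_eq_iff_nonneg)
  have "(sinh (dist c b))\<^sup>2 = (\<alpha> * sinh (dist a b))\<^sup>2"
  proof -
    have "(sinh (dist c b))\<^sup>2 = (\<alpha> * ?C + \<beta>)\<^sup>2 - 1"
      by (simp add: cosh_square_eq flip: cb)
    then show ?thesis using sq norm by algebra
  qed
  then have sb: "sinh (dist c b) = \<alpha> * sinh (dist a b)"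
    using assms by (simp add: power2_eq_iff_nonneg)
  have "cosh (dist a c + dist c b) = ?C"
    unfolding cosh_add ca cb sa sb using sq norm by algebra
  then have "dist a c + dist c b = dist a b"
    by (metis add_nonneg_nonneg arcosh_cosh_real zero_le_dist)
  then show ?thesis by (simp add: hseg_def)
qed

section \<open>Crossing segments\<close>

definition triple :: "real^3 \<Rightarrow> real^3 \<Rightarrow> real^3 \<Rightarrow> real" where
  "triple u v w = det (vector [u, v, w] :: real^3^3)"

lemma triple_expand:
  "triple u v w = u$1 * (v$2 * w$3 - v$3 * w$2) - u$2 * (v$1 * w$3 - v$3 * w$1)
     + u$3 * (v$1 * w$2 - v$2 * w$1)"
  by (simp add: triple_def det_3 algebra_simps)

lemma orientation_triple: "orientation x y z = triple (hvec x) (hvec y) (hvec z)"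
  by (simp add: orientation_def triple_def)

lemma triple_linear_right: "linear (triple u v)"
  by (rule linearI) (simp_all add: triple_expand algebra_simps)

lemma triple_rotate: "triple u v w = triple v w u"
  by (simp add: triple_expand algebra_simps)

lemma triple_degenerate [simp]: "triple u u w = 0" "triple u v v = 0" "triple u v u = 0"
  by (simp_all add: triple_expand algebra_simps)

lemma triple_combination:
  "triple (\<alpha> *\<^sub>R x + \<beta> *\<^sub>R y) v w = \<alpha> * triple x v w + \<beta> * triple y v w"
  "triple u v (\<alpha> *\<^sub>R x + \<beta> *\<^sub>R y) = \<alpha> * triple u v x + \<beta> * triple u v y"
  "triple u (\<alpha> *\<^sub>R x + \<beta> *\<^sub>R y) w = \<alpha> * triple u x w + \<beta> * triple u y w"
  by (simp_all add: triple_expand algebra_simps)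

text \<open>Cramer's rule, with the terms distributed so that all coefficients are nonnegative for
  four points in cyclic order.\<close>
lemma four_vectors_relation:
  "triple b c d *\<^sub>R a + triple a b d *\<^sub>R c = triple a c d *\<^sub>R b + triple a b c *\<^sub>R d"
  by (simp add: vec_eq_iff forall_3 triple_expand algebra_simps)

text \<open>The two sides of \<open>four_vectors_relation\<close> are one vector in the cone over the segment \<open>ac\<close> and in the
  cone over \<open>bd\<close>. Some orientation is positive, so this vector is not zero; normalised to the
  hyperboloid, it is a common point of the two diagonals. Weak orientations have to be admitted because the
  point of a side nearest to a vertex may coincide with a vertex.\<close>
lemma crossing_inequality:
  assumes "orientation a b c \<ge> 0" "orientation a b d \<ge> 0"
    and "orientation a c d \<ge> 0" "orientation b c d \<ge> 0"
    and "orientation a b c > 0 \<or> orientation a b d > 0"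
  shows "dist a b + dist c d \<le> dist a c + dist b d"
proof -
  let ?abc = "orientation a b c" and ?abd = "orientation a b d"
  let ?acd = "orientation a c d" and ?bcd = "orientation b c d"
  let ?u = "?bcd *\<^sub>R hvec a + ?abd *\<^sub>R hvec c"
  have u_eq: "?u = ?acd *\<^sub>R hvec b + ?abc *\<^sub>R hvec d"
    unfolding orientation_triple by (rule four_vectors_relation)
  have third: "?u $ 3 = ?bcd * hvec a $ 3 + ?abd * hvec c $ 3"
    "?u $ 3 = ?acd * hvec b $ 3 + ?abc * hvec d $ 3"
    by simp (subst u_eq, simp)
  have "?u $ 3 > 0"
    using assms(5)
  proof
    assume "?abc > 0"
    then show ?thesis unfolding third(2)
      using assms(1-4) by (intro add_nonneg_pos mult_nonneg_nonneg mult_pos_pos) (auto simp: hvec_pos less_imp_le)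
  next
    assume "?abd > 0"
    then show ?thesis unfolding third(1)
      using assms(1-4) by (intro add_nonneg_pos mult_nonneg_nonneg mult_pos_pos) (auto simp: hvec_pos less_imp_le)
  qed
  have "mink ?u ?u < 0"
  proof -
    have pos: "?bcd > 0 \<or> ?abd > 0"
      using \<open>?u $ 3 > 0\<close> assms unfolding third(1) by (smt (verit) mult_eq_0_iff)
    have "mink ?u ?u \<le> - ?bcd\<^sup>2 - ?abd\<^sup>2"
      unfolding mink_combination_self hvec_mink_self mink_hvec
      using assms cosh_real_nonneg[of "dist a c"] by simp
    also have "\<dots> < 0" 
      using pos by (smt (verit) zero_less_power zero_le_power2)
    finally show ?thesis .
  qed
  define r where "r = 1 / sqrt (- mink ?u ?u)"
  have "r > 0" and r2: "r\<^sup>2 * mink ?u ?u = -1"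
    using \<open>mink ?u ?u < 0\<close> by (auto simp: r_def power_divide)
  have "mink (r *\<^sub>R ?u) (r *\<^sub>R ?u) = r\<^sup>2 * mink ?u ?u"
    by (simp add: mink_def power2_eq_square algebra_simps)
  moreover have "(r *\<^sub>R ?u) $ 3 > 0"
    using mult_pos_pos[OF \<open>r > 0\<close> \<open>?u $ 3 > 0\<close>] by (simp only: vector_scaleR_component real_scaleR_def)
  ultimately obtain x where x: "hvec x = r *\<^sub>R ?u"
    using point_on_upper_sheet[of "r *\<^sub>R ?u"] r2 by auto
  have "x \<in> hseg a c"
    by (rule combination_in_hseg[of "r * ?bcd" "r * ?abd"])
       (use assms \<open>r > 0\<close> in \<open>simp_all add: x scaleR_add_right\<close>)
  moreover have "x \<in> hseg b d"
    by (rule combination_in_hseg[of "r * ?acd" "r * ?abc"])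
       (use assms \<open>r > 0\<close> in \<open>simp_all add: x u_eq scaleR_add_right\<close>)
  ultimately have "dist a x + dist x c = dist a c" "dist b x + dist x d = dist b d"
    by (simp_all add: hseg_def)
  moreover have "dist a b \<le> dist a x + dist b x" "dist c d \<le> dist x c + dist x d"
    using dist_triangle[of a b x] dist_triangle[of c d x] by (simp_all add: dist_commute)
  ultimately show ?thesis by linarith
qed

section \<open>Linear functionals on convex hulls\<close>

text \<open>The condition \<open>c \<ge> 0\<close> matters: coefficients of a combination in a segment have a sum of at most one,
  which moves values towards zero.\<close>
lemma hconvex_linear_sublevel:
  fixes L :: "real^3 \<Rightarrow> real"
  assumes "linear L" "c \<ge> 0"
  shows "hconvex {x. L (hvec x) \<le> c}"
  unfolding hconvex_def
proof (intro ballI subsetI)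
  fix x y z assume xy: "x \<in> {x. L (hvec x) \<le> c}" "y \<in> {x. L (hvec x) \<le> c}" and "z \<in> hseg x y"
  from \<open>z \<in> hseg x y\<close> obtain \<alpha> \<beta> where ab: "\<alpha> \<ge> 0" "\<beta> \<ge> 0"
      "hvec z = \<alpha> *\<^sub>R hvec x + \<beta> *\<^sub>R hvec y" "z \<noteq> x \<Longrightarrow> z \<noteq> y \<Longrightarrow> \<alpha> + \<beta> < 1"
    by (rule hseg_combination) blast
  show "z \<in> {x. L (hvec x) \<le> c}"
  proof (cases "z = x \<or> z = y")
    case False
    then have "\<alpha> + \<beta> < 1" using ab by blast
    have "L (hvec z) = \<alpha> * L (hvec x) + \<beta> * L (hvec y)"
      using assms(1) ab(3) by (simp add: linear_add linear_scale)
    also have "\<dots> \<le> \<alpha> * c + \<beta> * c"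
      using xy ab by (intro add_mono mult_left_mono) auto
    also have "\<dots> = (\<alpha> + \<beta>) * c" by (simp add: algebra_simps)
    also have "\<dots> \<le> 1 * c" using \<open>\<alpha> + \<beta> < 1\<close> assms(2) by (intro mult_right_mono) auto
    finally show ?thesis by simp
  qed (use xy in auto)
qed

text \<open>A positive maximal value is not attained in the interior of a segment, where the coefficients add up to
  less than one.\<close>
lemma hconvex_linear_sublevel_minus_top:
  fixes L :: "real^3 \<Rightarrow> real"
  assumes "linear L" "L (hvec y) > 0"
  shows "hconvex ({x. L (hvec x) \<le> L (hvec y)} - {y})"
  unfolding hconvex_def
proof (intro ballI subsetI)
  fix a b z assume ab: "a \<in> {x. L (hvec x) \<le> L (hvec y)} - {y}"
    "b \<in> {x. L (hvec x) \<le> L (hvec y)} - {y}" and z: "z \<in> hseg a b"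
  have "z \<in> {x. L (hvec x) \<le> L (hvec y)}"
    using hconvex_linear_sublevel[of L "L (hvec y)"] assms ab z
    unfolding hconvex_def by (meson DiffD1 less_imp_le subsetD)
  moreover have "z \<noteq> y"
  proof
    assume "z = y"
    with ab have ne: "z \<noteq> a" "z \<noteq> b" by auto
    from z obtain \<alpha> \<beta> where c: "\<alpha> \<ge> 0" "\<beta> \<ge> 0"
        "hvec z = \<alpha> *\<^sub>R hvec a + \<beta> *\<^sub>R hvec b" "z \<noteq> a \<Longrightarrow> z \<noteq> b \<Longrightarrow> \<alpha> + \<beta> < 1"
      by (rule hseg_combination) blast
    then have "\<alpha> + \<beta> < 1" using ne by blast
    have "L (hvec z) = \<alpha> * L (hvec a) + \<beta> * L (hvec b)"
      using assms(1) c(3) by (simp add: linear_add linear_scale)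
    also have "\<dots> \<le> \<alpha> * L (hvec y) + \<beta> * L (hvec y)"
      using ab c by (intro add_mono mult_left_mono) auto
    also have "\<dots> = (\<alpha> + \<beta>) * L (hvec y)" by (simp add: algebra_simps)
    also have "\<dots> < 1 * L (hvec y)"
      using \<open>\<alpha> + \<beta> < 1\<close> assms(2) by (intro mult_strict_right_mono) auto
    finally show False using \<open>z = y\<close> by simp
  qed
  ultimately show "z \<in> {x. L (hvec x) \<le> L (hvec y)} - {y}" by blast
qed

text \<open>A generating point \<open>y\<close> with the largest positive value is a vertex: the sublevel set without \<open>y\<close> is
  convex and contains all other generating points, so \<open>y\<close> is not in their hull.\<close>
lemma linear_le_on_hull:
  fixes L :: "real^3 \<Rightarrow> real"
  assumes "finite V" "linear L" "c \<ge> 0"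
    and le: "\<And>v. v \<in> hull_vertices V \<Longrightarrow> L (hvec v) \<le> c"
    and "x \<in> hconvex hull V"
  shows "L (hvec x) \<le> c"
proof -
  have "V \<subseteq> {x. L (hvec x) \<le> c}"
  proof (rule ccontr)
    assume "\<not> ?thesis"
    then obtain v where "v \<in> V" "\<not> L (hvec v) \<le> c" by blast
    then have v: "v \<in> V" "L (hvec v) > c" by simp_all
    let ?M = "Max ((\<lambda>x. L (hvec x)) ` V)"
    have "?M \<in> (\<lambda>x. L (hvec x)) ` V"
      using assms(1) v by (intro Max_in) auto
    then obtain y where y: "y \<in> V" "L (hvec y) = ?M" by auto
    have top: "L (hvec u) \<le> L (hvec y)" if "u \<in> V" for u
      using y(2) that assms(1) by (simp add: Max_ge)
    have "L (hvec y) > c" using top v by fastforce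
    have "hconvex hull (V - {y}) \<subseteq> {x. L (hvec x) \<le> L (hvec y)} - {y}"
      using top \<open>L (hvec y) > c\<close> assms
      by (intro hull_minimal hconvex_linear_sublevel_minus_top) auto
    with y(1) have "y \<in> hull_vertices V" by (auto simp: hull_vertices_def)
    with le \<open>L (hvec y) > c\<close> show False by fastforce
  qed
  then have "hconvex hull V \<subseteq> {x. L (hvec x) \<le> c}"
    using assms by (intro hull_minimal hconvex_linear_sublevel)
  with assms(5) show ?thesis by blast
qed

text \<open>\<open>cosh (dist z x)\<close> is a linear functional of \<open>hvec x\<close>.\<close>
lemma dist_le_on_hull:
  assumes "finite V" "\<And>v. v \<in> hull_vertices V \<Longrightarrow> dist v z \<le> r" "r \<ge> 0" "x \<in> hconvex hull V"
  shows "dist x z \<le> r"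
proof -
  have "linear (\<lambda>u. - mink (hvec z) u)"
    using linear_compose_neg[OF mink_linear_right] .
  moreover have "- mink (hvec z) (hvec v) \<le> cosh r" if "v \<in> hull_vertices V" for v
    using assms(2)[OF that] assms(3) by (simp add: mink_hvec dist_commute cosh_real_nonneg_le_iff)
  ultimately have "- mink (hvec z) (hvec x) \<le> cosh r"
    using linear_le_on_hull[of V "\<lambda>u. - mink (hvec z) u" "cosh r" x] assms by simp
  then show ?thesis
    using assms(3) by (simp add: mink_hvec dist_commute cosh_real_nonneg_le_iff)
qed

text \<open>The geodesic from \<open>b\<close> to \<open>z\<close>, prolonged a little beyond \<open>z\<close>, leaves the half-plane \<open>L \<ge> 0\<close>. So no
  ball around \<open>z\<close> is contained in \<open>P\<close>.\<close>
lemma frontier_of_supported: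
  fixes L :: "real^3 \<Rightarrow> real"
  assumes L: "linear L" "\<And>x. x \<in> P \<Longrightarrow> L (hvec x) \<ge> 0"
    and z: "z \<in> P" "L (hvec z) = 0" and b: "L (hvec b) > 0"
  shows "z \<in> frontier P"
proof -
  have "z \<notin> interior P"
  proof
    assume "z \<in> interior P"
    then obtain e where e: "e > 0" "ball z e \<subseteq> P"
      by (meson mem_interior)
    define \<delta> D where "\<delta> = e / 2" and "D = dist z b"
    have "\<delta> > 0" using e by (simp add: \<delta>_def)
    have "z \<noteq> b" using z b by auto
    then have S: "sinh D > 0" by (simp add: D_def)
    define \<beta> where "\<beta> = sinh \<delta> / sinh D"
    have "\<beta> > 0" using S \<open>\<delta> > 0\<close> by (simp add: \<beta>_def)
    \<comment> \<open>The point at distance \<open>\<delta>\<close> beyond \<open>z\<close> on the geodesic that starts at \<open>b\<close>.\<close>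
    let ?u = "(cosh \<delta> + \<beta> * cosh D) *\<^sub>R hvec z + (- \<beta>) *\<^sub>R hvec b"
    have zu: "mink (hvec z) ?u = - cosh \<delta>"
      unfolding mink_combination_right by (simp add: hvec_mink_self mink_hvec D_def)
    have "mink ?u ?u = -1"
    proof -
      have "mink ?u ?u = - (cosh \<delta>)\<^sup>2 + \<beta>\<^sup>2 * ((cosh D)\<^sup>2 - 1)"
        unfolding mink_combination_self hvec_mink_self mink_hvec D_def[symmetric] by algebra
      also have "\<beta>\<^sup>2 * ((cosh D)\<^sup>2 - 1) = (sinh \<delta>)\<^sup>2"
        using S by (simp add: \<beta>_def cosh_square_eq power_divide)
      finally show ?thesis by (simp add: cosh_square_eq)
    qed
    then obtain x where x: "hvec x = ?u"
      using point_at_timelike_vector[of ?u z] zu by auto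
    have "cosh (dist z x) = cosh \<delta>" by (simp add: cosh_dist x zu del: scaleR_minus_left)
    then have "dist z x = \<delta>"
      using \<open>\<delta> > 0\<close> by (metis arcosh_cosh_real less_imp_le zero_le_dist)
    then have "x \<in> P" using e by (auto simp: \<delta>_def)
    moreover have "L (hvec x) = - \<beta> * L (hvec b)"
      unfolding x using L(1) z(2) by (simp add: linear_add linear_scale linear_diff)
    moreover have "\<beta> * L (hvec b) > 0" using \<open>\<beta> > 0\<close> b by simp
    ultimately show False using L(2)[of x] by simp
  qed
  then show ?thesis
    using z(1) closure_subset by (auto simp: frontier_def)
qed

section \<open>The combinatorial argument\<close>

lemma residue_in_window:
  fixes a k n :: nat
  assumes "n > 0"
  obtains j where "a \<le> j" "j < a + n" "j mod n = k mod n"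
proof -
  have "(a + (k + (n - 1) * a) mod n) mod n = (a + (k + (n - 1) * a)) mod n"
    by (rule mod_add_right_eq)
  also have "a + (k + (n - 1) * a) = k + n * a"
    using assms by (cases n) simp_all
  finally show thesis
    using that[of "a + (k + (n - 1) * a) mod n"] assms by simp
qed

text \<open>The hypotheses \<open>after\<close>, \<open>before\<close> and \<open>feet\<close> are the crossing inequality for the quadruples
  \<open>V p, V q, V k, T q\<close>, then \<open>V p, V q, T p, V k\<close>, then \<open>V k, T i, T (i + 1), V l\<close>. The
  vertices before \<open>V i\<close> carry the indices \<open>i + m + 1, \<dots>, i + 2 * m\<close>, so that the order of indices is the
  cyclic order. The two one-sided maxima \<open>M\<^sub>r\<close> and \<open>M\<^sub>l\<close> also include \<open>V i\<close> itself (as \<open>V (i + n)\<close> in the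
  second case), hence are at least \<open>w\<close>; \<open>M\<^sub>r i - M\<^sub>l i\<close> falls below zero somewhere between
  \<open>p\<close> and \<open>q\<close>, while at every such step the inequality \<open>feet\<close> bounds \<open>M\<^sub>r i - M\<^sub>l i\<close> by its successor.\<close>
lemma exists_central_foot:
  fixes V T :: "nat \<Rightarrow> 'a::metric_space"
  assumes n: "n = 2 * m + 1" and "m > 0"
    and period: "\<And>i. V (i mod n) = V i"
    and foot: "\<And>i. dist (V i) (T i) = w"
    and after: "\<And>p q k. p < q \<Longrightarrow> q \<le> p + m \<Longrightarrow> q < k \<Longrightarrow> k \<le> q + m \<Longrightarrow>
      dist (V p) (V q) + dist (V k) (T q) \<le> dist (V p) (V k) + dist (V q) (T q)"
    and before: "\<And>p q k. p < q \<Longrightarrow> q \<le> p + m \<Longrightarrow> p + m < k \<Longrightarrow> k < p + n \<Longrightarrow>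
      dist (V p) (V q) + dist (T p) (V k) \<le> dist (V p) (T p) + dist (V q) (V k)"
    and feet: "\<And>i k l. i < k \<Longrightarrow> k \<le> i + m \<Longrightarrow> i + m + 2 \<le> l \<Longrightarrow> l \<le> i + n \<Longrightarrow>
      dist (V k) (T i) + dist (T (Suc i)) (V l) \<le> dist (V k) (T (Suc i)) + dist (T i) (V l)"
  shows "\<exists>i. \<forall>k. dist (V k) (T i) \<le> w"
proof (rule ccontr)
  assume "\<not> ?thesis"
  then have bad: "\<exists>k. dist (V k) (T i) > w" for i
    by (meson not_le)
  have wrap: "V (i + n) = V i" for i
    by (metis mod_add_self2 period)
  \<comment> \<open>Since \<open>n = 2 * m + 1\<close>, every unordered pair of distinct vertices is \<open>V p, V q\<close> for exactly one pair
    of indices with \<open>p < n\<close> and \<open>p < q \<le> p + m\<close>, so a farthest pair can be taken of this form.\<close>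
  define R where "R = (SIGMA p:{..<n}. {Suc p..p + m})"
  define \<Delta> where "\<Delta> = Max ((\<lambda>(p, q). dist (V p) (V q)) ` R)"
  have "finite R" by (simp add: R_def)
  have "(0, 1) \<in> R" using \<open>m > 0\<close> n by (simp add: R_def)
  then have "\<Delta> \<in> (\<lambda>(p, q). dist (V p) (V q)) ` R"
    unfolding \<Delta>_def using \<open>finite R\<close> by (intro Max_in) auto
  then obtain p q where "(p, q) \<in> R" and \<Delta>: "\<Delta> = dist (V p) (V q)"
    by auto
  then have pq: "p < q" "q \<le> p + m" "dist (V p) (V q) = \<Delta>"
    by (auto simp: R_def)
  have R_le: "dist (V a) (V b) \<le> \<Delta>" if "(a, b) \<in> R" for a b
    unfolding \<Delta>_def using \<open>finite R\<close> that by (intro Max_ge) force+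
  have R_cases: "a = b \<or> (a, b) \<in> R \<or> (b, a + n) \<in> R" if "a \<le> b" "b < n" for a b
    using that by (auto simp: R_def n)
  have ordered: "dist (V a) (V b) \<le> \<Delta>" if "a \<le> b" "b < n" for a b
    using R_cases[OF that] R_le wrap dist_commute zero_le_dist pq(3)
    by (metis dist_self)
  have diam: "dist (V a) (V b) \<le> \<Delta>" for a b
  proof -
    have "a mod n < n" "b mod n < n" using n by simp_all
    then have "dist (V (a mod n)) (V (b mod n)) \<le> \<Delta>"
      using ordered by (metis dist_commute linear)
    then show ?thesis by (simp add: period)
  qed
  define M\<^sub>r where "M\<^sub>r i = Max ((\<lambda>k. dist (V k) (T i)) ` {i..i + m})" for i
  define M\<^sub>l where "M\<^sub>l i = Max ((\<lambda>k. dist (V k) (T i)) ` {Suc (i + m)..i + n})" for i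
  have r_ge: "dist (V k) (T i) \<le> M\<^sub>r i" if "i \<le> k" "k \<le> i + m" for i k
    unfolding M\<^sub>r_def using that by (intro Max_ge) auto
  have l_ge: "dist (V k) (T i) \<le> M\<^sub>l i" if "i + m < k" "k \<le> i + n" for i k
    unfolding M\<^sub>l_def using that by (intro Max_ge) auto
  have r_in: "\<exists>k. i \<le> k \<and> k \<le> i + m \<and> M\<^sub>r i = dist (V k) (T i)" for i
  proof -
    have "M\<^sub>r i \<in> (\<lambda>k. dist (V k) (T i)) ` {i..i + m}"
      unfolding M\<^sub>r_def by (intro Max_in) auto
    then show ?thesis by auto
  qed
  have l_in: "\<exists>k. i + m < k \<and> k \<le> i + n \<and> M\<^sub>l i = dist (V k) (T i)" for i
  proof -
    have "M\<^sub>l i \<in> (\<lambda>k. dist (V k) (T i)) ` {Suc (i + m)..i + n}"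
      unfolding M\<^sub>l_def using n by (intro Max_in) auto
    then show ?thesis by (auto simp: Suc_le_eq)
  qed
  have some_far: "M\<^sub>r i > w \<or> M\<^sub>l i > w" for i
  proof -
    obtain k where k: "dist (V k) (T i) > w" using bad by blast
    obtain j where "i \<le> j" "j < i + n" "j mod n = k mod n"
      using residue_in_window[of n i k] n by auto
    moreover from this have "V j = V k" by (metis period)
    ultimately show ?thesis
      using k r_ge[of i j] l_ge[of i j] by (smt (verit) less_imp_le_nat not_le)
  qed
  \<comment> \<open>A vertex after \<open>V q\<close> and farther than \<open>w\<close> from \<open>T q\<close> would be farther from \<open>V p\<close> than \<open>V q\<close>.\<close>
  have "M\<^sub>r q \<le> w"
  proof -
    obtain k where k: "q \<le> k" "k \<le> q + m" "M\<^sub>r q = dist (V k) (T q)" using r_in by blast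
    show ?thesis
    proof (cases "k = q")
      case False
      then show ?thesis using after[of p q k] pq k diam[of p k] foot[of q] by simp
    qed (use k foot in simp)
  qed
  then have at_q: "M\<^sub>r q < M\<^sub>l q" using some_far[of q] by linarith
  have "M\<^sub>l p \<le> w"
  proof -
    obtain k where k: "p + m < k" "k \<le> p + n" "M\<^sub>l p = dist (V k) (T p)" using l_in by blast
    show ?thesis
    proof (cases "k = p + n")
      case False
      then show ?thesis
        using before[of p q k] pq k diam[of q k] foot[of p] by (simp add: dist_commute)
    qed (use k foot wrap in simp)
  qed
  then have at_p: "M\<^sub>l p \<le> M\<^sub>r p" using some_far[of p] by linarith
  obtain i where i: "M\<^sub>l i \<le> M\<^sub>r i" "M\<^sub>r (Suc i) < M\<^sub>l (Suc i)"
  proof (rule ccontr)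
    assume no: "\<not> thesis"
    have "M\<^sub>l q \<le> M\<^sub>r q"
      using less_imp_le[OF pq(1)]
      by (induction q rule: dec_induct) (use at_p no that in \<open>auto simp: not_less[symmetric]\<close>)
    with at_q show False by simp
  qed
  obtain k where k: "i \<le> k" "k \<le> i + m" "M\<^sub>r i = dist (V k) (T i)" using r_in by blast
  have "M\<^sub>r i > w" using i some_far[of i] by linarith
  then have "i < k" using k foot[of i] by (metis le_neq_implies_less less_irrefl)
  obtain l where l: "Suc i + m < l" "l \<le> Suc i + n" "M\<^sub>l (Suc i) = dist (V l) (T (Suc i))"
    using l_in by blast
  have "M\<^sub>l (Suc i) > w" using i some_far[of "Suc i"] by linarith
  then have "l \<noteq> Suc i + n" using l(3) foot[of "Suc i"] wrap by (metis less_irrefl)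
  \<comment> \<open>After the exchange, \<open>V k\<close> is still after \<open>V (i + 1)\<close> or equal to it, and \<open>V l\<close> still before \<open>V i\<close>
    or equal to it.\<close>
  have "M\<^sub>r i + M\<^sub>l (Suc i) \<le> dist (V k) (T (Suc i)) + dist (T i) (V l)"
    using feet[of i k l] \<open>i < k\<close> \<open>l \<noteq> Suc i + n\<close> k l by (simp add: dist_commute)
  also have "\<dots> \<le> M\<^sub>r (Suc i) + M\<^sub>l i"
    using r_ge[of "Suc i" k] l_ge[of i l] \<open>i < k\<close> \<open>l \<noteq> Suc i + n\<close> k l
    by (simp add: dist_commute add_mono)
  finally show False using i by linarith
qed

section \<open>Ordinary reduced polygons\<close>

lemma infdist_attained_on_compact:
  fixes x :: "'a::metric_space"
  assumes "compact S" "S \<noteq> {}"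
  obtains t where "t \<in> S" "infdist x S = dist x t"
proof -
  have "continuous_on S (dist x)" by (intro continuous_intros)
  then obtain t where t: "t \<in> S" "\<forall>y\<in>S. dist x t \<le> dist x y"
    using continuous_attains_inf[OF assms] by blast
  have "infdist x S = dist x t"
  proof (rule antisym)
    show "infdist x S \<le> dist x t" using t(1) by (rule infdist_le)
    show "dist x t \<le> infdist x S"
      using t assms(2) by (auto simp: infdist_def intro!: cINF_greatest)
  qed
  with t(1) show thesis by (rule that)
qed

text \<open>Increasing triples within one period of the index remain positively oriented, since reduction
  modulo \<open>n\<close> only rotates them.\<close>
lemma cyclic_orientation:
  fixes n :: nat
  assumes or: "\<And>i j k. i < j \<Longrightarrow> j < k \<Longrightarrow> k < n \<Longrightarrow> orientation (v i) (v j) (v k) > 0"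
    and ijk: "i < j" "j < k" "k < i + n"
  shows "orientation (v (i mod n)) (v (j mod n)) (v (k mod n)) > 0"
proof -
  have n: "n > 0" using ijk by linarith
  define e where "e = i div n"
  define c where "c = n * e"
  define a x y where "a = i - c" and "x = j - c" and "y = k - c"
  have "c \<le> i" by (simp add: c_def e_def)
  then have eq: "i = a + c" "j = x + c" "k = y + c"
    using ijk by (simp_all add: a_def x_def y_def)
  have "a = i mod n" by (simp add: a_def c_def e_def minus_mult_div_eq_mod)
  then have "a < n" using n by simp
  have ord: "a < x" "x < y" "y < a + n" using eq ijk by linarith+
  have mods: "i mod n = a" "j mod n = x mod n" "k mod n = y mod n"
    using \<open>a < n\<close> by (simp_all add: eq c_def)
  consider "y < n" | "x < n" "n \<le> y" | "n \<le> x" by linarith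
  then show ?thesis
  proof cases
    case 1
    then show ?thesis using or[of a x y] ord mods by simp
  next
    case 2
    then have "y mod n = y - n" using ord \<open>a < n\<close> by (simp add: mod_if)
    then show ?thesis
      using or[of "y - n" a x] 2 ord mods unfolding orientation_triple
      by (simp add: triple_rotate[of "hvec (v (y - n))"])
  next
    case 3
    then have "x mod n = x - n" "y mod n = y - n" using ord \<open>a < n\<close> by (simp_all add: mod_if)
    then show ?thesis
      using or[of "x - n" "y - n" a] 3 ord mods \<open>a < n\<close> unfolding orientation_triple
      by (simp add: triple_rotate[of "hvec (v a)"])
  qed
qed

lemma orientation_nonneg:
  fixes V :: "nat \<Rightarrow> hyp2" and n :: nat
  assumes period: "\<And>i. V (i mod n) = V i"
    and pos: "\<And>i j k. i < j \<Longrightarrow> j < k \<Longrightarrow> k < i + n \<Longrightarrow> orientation (V i) (V j) (V k) > 0"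
    and ijk: "i \<le> j" "j \<le> k" "k \<le> i + n"
  shows "orientation (V i) (V j) (V k) \<ge> 0"
proof (cases "i < j \<and> j < k \<and> k < i + n")
  case True
  then show ?thesis using pos less_imp_le by blast
next
  case False
  then have "i = j \<or> j = k \<or> k = i + n" using ijk by linarith
  then have "V i = V j \<or> V j = V k \<or> V k = V i"
    by (metis mod_add_self2 period)
  then show ?thesis by (auto simp: orientation_triple)
qed

text \<open>Expanding each \<open>T i\<close> in the endpoints of its side turns every orientation condition of the crossing
  inequality into one on vertices. For the first two quadruples three vertices guarantee the positive
  orientation. For the third, \<open>V k, T i, V l\<close> do, unless \<open>T i = V k\<close>, when the claim is the triangle
  inequality.\<close>
lemma exists_central_foot_of_polygon:
  fixes V T :: "nat \<Rightarrow> hyp2"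
  assumes n: "n = 2 * m + 1" and "m > 0"
    and period: "\<And>i. V (i mod n) = V i"
    and pos: "\<And>i j k. i < j \<Longrightarrow> j < k \<Longrightarrow> k < i + n \<Longrightarrow> orientation (V i) (V j) (V k) > 0"
    and T_seg: "\<And>i. T i \<in> hseg (V (i + m)) (V (Suc (i + m)))"
    and T_dist: "\<And>i. dist (V i) (T i) = w"
  shows "\<exists>i. \<forall>k. dist (V k) (T i) \<le> w"
proof -
  note nonneg = orientation_nonneg[of V n, OF period pos]
  have "\<exists>\<alpha> \<beta>. \<alpha> \<ge> 0 \<and> \<beta> \<ge> 0 \<and> hvec (T i) = \<alpha> *\<^sub>R hvec (V (i + m)) + \<beta> *\<^sub>R hvec (V (Suc (i + m)))
      \<and> (T i \<noteq> V (i + m) \<longrightarrow> \<beta> > 0) \<and> (T i \<noteq> V (Suc (i + m)) \<longrightarrow> \<alpha> > 0)" for i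
    using T_seg[of i] by (rule hseg_combination) blast
  then obtain \<alpha> \<beta> where ab: "\<alpha> i \<ge> 0" "\<beta> i \<ge> 0"
      and T: "hvec (T i) = \<alpha> i *\<^sub>R hvec (V (i + m)) + \<beta> i *\<^sub>R hvec (V (Suc (i + m)))"
      and b_pos: "T i \<noteq> V (i + m) \<Longrightarrow> \<beta> i > 0"
      and a_pos: "T i \<noteq> V (Suc (i + m)) \<Longrightarrow> \<alpha> i > 0" for i
    by metis
  have foot1: "orientation (T i) x y
      = \<alpha> i * orientation (V (i + m)) x y + \<beta> i * orientation (V (Suc (i + m))) x y" for x y i
    unfolding orientation_triple T by (rule triple_combination)
  have foot2: "orientation x (T i) y
      = \<alpha> i * orientation x (V (i + m)) y + \<beta> i * orientation x (V (Suc (i + m))) y" for x y i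
    unfolding orientation_triple T by (rule triple_combination)
  have foot3: "orientation x y (T i)
      = \<alpha> i * orientation x y (V (i + m)) + \<beta> i * orientation x y (V (Suc (i + m)))" for x y i
    unfolding orientation_triple T by (rule triple_combination)
  show ?thesis
  proof (rule exists_central_foot[where V = V and T = T, OF n \<open>m > 0\<close> period T_dist])
    fix p q k assume "p < q" "q \<le> p + m" "q < k" "k \<le> q + m"
    then show "dist (V p) (V q) + dist (V k) (T q) \<le> dist (V p) (V k) + dist (V q) (T q)"
      unfolding n using ab
      by (intro crossing_inequality disjI1)
         (auto simp: foot3 n intro!: add_nonneg_nonneg mult_nonneg_nonneg nonneg pos)
  next
    fix p q k assume "p < q" "q \<le> p + m" "p + m < k" "k < p + n"
    then show "dist (V p) (V q) + dist (T p) (V k) \<le> dist (V p) (T p) + dist (V q) (V k)"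
      using ab
      by (intro crossing_inequality disjI2)
         (auto simp: foot2 foot3 n intro!: add_nonneg_nonneg mult_nonneg_nonneg nonneg pos)
  next
    fix i k l assume ikl: "i < k" "k \<le> i + m" "i + m + 2 \<le> l" "l \<le> i + n"
    show "dist (V k) (T i) + dist (T (Suc i)) (V l) \<le> dist (V k) (T (Suc i)) + dist (T i) (V l)"
    proof (cases "T i = V k")
      case True
      then show ?thesis using dist_triangle3[of "T (Suc i)" "V l" "V k"] by (simp add: dist_commute)
    next
      case False
      have "orientation (V k) (T i) (V l) > 0"
      \<comment> \<open>If \<open>k = i + m\<close>, the first term of the expansion of \<open>T i\<close> contributes zero, and the other coefficient
        has to be positive.\<close>
      proof (cases "k = i + m")
        case True
        then have "\<beta> i > 0" using False b_pos by simp
        then show ?thesis unfolding foot2 using ikl ab n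
          by (intro add_nonneg_pos mult_nonneg_nonneg mult_pos_pos nonneg pos) auto
      next
        case ne: False
        have or1: "orientation (V k) (V (i + m)) (V l) > 0"
          "orientation (V k) (V (Suc (i + m))) (V l) > 0"
          using ikl ne n by (auto intro!: pos)
        have "\<alpha> i \<noteq> 0 \<or> \<beta> i \<noteq> 0"
          using T[of i] hvec_pos[of "T i"] by (auto simp del: zero_index)
        then have "\<alpha> i > 0 \<or> \<beta> i > 0" using ab[of i] by linarith
        then show ?thesis unfolding foot2 using or1 ab[of i]
          by (auto intro: add_nonneg_pos add_pos_nonneg)
      qed
      then show ?thesis using ikl ab
        by (intro crossing_inequality disjI2)
           (auto simp: foot1 foot2 foot3 n intro!: add_nonneg_nonneg mult_nonneg_nonneg nonneg)
    qed
  qed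
qed

theorem theorem1p3:
  fixes w :: real and P :: "hyp2 set"
  assumes "w > 0"
    and "ordinary_reduced_polygon P w"
  shows "\<exists>z \<in> frontier P. \<forall>x \<in> P. dist x z \<le> w"
proof -
  obtain n v where "odd n" and "n \<ge> 3" and gon: "oriented_gon n v P"
    and inf: "\<And>i. i < n \<Longrightarrow> infdist (v i) (hseg (opp1 n v i) (opp2 n v i)) = w"
    using assms(2) unfolding ordinary_reduced_polygon_def by blast
  obtain m where n: "n = 2 * m + 1" using \<open>odd n\<close> by (rule oddE)
  have "m > 0" using n \<open>n \<ge> 3\<close> by simp
  obtain X where X: "finite X" "P = hconvex hull X" "bij_betw v {..<n} (hull_vertices X)"
    and or: "\<And>i j k. i < j \<Longrightarrow> j < k \<Longrightarrow> k < n \<Longrightarrow> orientation (v i) (v j) (v k) > 0"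
    and "compact P" "hconvex P"
    using gon unfolding oriented_gon_def convex_body_def by blast
  define V where "V i = v (i mod n)" for i
  have V_period: "V (i mod n) = V i" for i by (simp add: V_def)
  have hv: "hull_vertices X = range V"
  proof -
    have "hull_vertices X = v ` {..<n}" using X(3) by (simp add: bij_betw_def)
    also have "{..<n} = range (\<lambda>i. i mod n)"
    proof
      show "{..<n} \<subseteq> range (\<lambda>i. i mod n)"
        by (metis lessThan_iff mod_less rangeI subsetI)
      show "range (\<lambda>i. i mod n) \<subseteq> {..<n}" using \<open>n \<ge> 3\<close> by auto
    qed
    finally show ?thesis by (simp add: V_def image_image)
  qed
  have V_in: "V i \<in> P" for i
  proof -
    have "V i \<in> X" using hv by (auto simp: hull_vertices_def)
    then show ?thesis unfolding X(2) by (rule hull_inc)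
  qed
  have pos: "orientation (V i) (V j) (V k) > 0" if "i < j" "j < k" "k < i + n" for i j k
    unfolding V_def using or that by (rule cyclic_orientation)
  \<comment> \<open>The distance to a side is attained because the side is a closed subset of the compact polygon.\<close>
  have "\<exists>t. t \<in> hseg (V (i + m)) (V (Suc (i + m))) \<and> dist (V i) t = w" for i
  proof -
    let ?s = "hseg (V (i + m)) (V (Suc (i + m)))"
    have "closed ?s"
      unfolding hseg_def by (intro closed_Collect_eq continuous_intros)
    moreover have "?s \<subseteq> P" using \<open>hconvex P\<close> V_in unfolding hconvex_def by blast
    ultimately have "compact ?s"
      using compact_Int_closed[OF \<open>compact P\<close>, of ?s] by (simp add: Int_absorb1)
    moreover have "V (i + m) \<in> ?s" by (simp add: hseg_def)
    ultimately obtain t where "t \<in> ?s" "infdist (V i) ?s = dist (V i) t"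
      using infdist_attained_on_compact by blast
    moreover have "opp1 n v (i mod n) = V (i + m)" "opp2 n v (i mod n) = V (Suc (i + m))"
    proof -
      have "(n - 1) div 2 = m" "(n + 1) div 2 = Suc m" by (simp_all add: n)
      then show "opp1 n v (i mod n) = V (i + m)" "opp2 n v (i mod n) = V (Suc (i + m))"
        unfolding opp1_def opp2_def V_def by (simp_all only: mod_add_left_eq add_Suc_right[symmetric])
    qed
    then have "infdist (V i) ?s = w"
      using inf[of "i mod n"] \<open>n \<ge> 3\<close> by (simp add: V_def)
    ultimately show ?thesis by metis
  qed
  then obtain T where T_seg: "T i \<in> hseg (V (i + m)) (V (Suc (i + m)))"
    and T_dist: "dist (V i) (T i) = w" for i
    by metis
  obtain i where near: "\<And>k. dist (V k) (T i) \<le> w"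
    using exists_central_foot_of_polygon[OF n \<open>m > 0\<close> V_period pos T_seg T_dist] by blast
  let ?L = "triple (hvec (V (i + m))) (hvec (V (Suc (i + m))))"
  have "T i \<in> frontier P"
  proof (rule frontier_of_supported[of ?L])
    show "linear ?L" by (rule triple_linear_right)
    fix x assume "x \<in> P"
    show "?L (hvec x) \<ge> 0"
    proof -
      have "- ?L (hvec (V k)) \<le> 0" for k
      proof -
        obtain j where "i + m \<le> j" "j < i + m + n" "j mod n = k mod n"
          using residue_in_window[of n "i + m" k] n by auto
        moreover from this have "V j = V k" by (simp add: V_def)
        ultimately show ?thesis 
          using orientation_nonneg[of V n "i + m" "Suc (i + m)" j, OF V_period pos] by (cases "j = i + m") (auto simp: orientation_triple)
      qed
      then show ?thesis
        using linear_le_on_hull[OF X(1) linear_compose_neg[OF triple_linear_right], of 0] \<open>x \<in> P\<close>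
        unfolding X(2) hv by fastforce
    qed
  next
    show "T i \<in> P"
      using \<open>hconvex P\<close> V_in T_seg unfolding hconvex_def by blast
    show "?L (hvec (T i)) = 0"
      using T_seg[of i] by (rule hseg_combination) (simp add: triple_combination)
    \<comment> \<open>Since \<open>n \<ge> 3\<close>, the vertex after the side differs from both of its endpoints.\<close>
    show "?L (hvec (V (i + m + 2))) > 0"
      using pos[of "i + m" "Suc (i + m)" "i + m + 2"] \<open>n \<ge> 3\<close> by (simp add: orientation_triple)
  qed
  moreover have "dist x (T i) \<le> w" if "x \<in> P" for x
    using dist_le_on_hull[of X "T i" w x] near X hv that \<open>w > 0\<close> by auto
  ultimately show ?thesis by blast
qed

end
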